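(* Let $m,n \in [d]=\{1,\dots,d\}$, $\pi \in \operatorname{Aff}_d$, and $\sigma \in S_d$ be such that $\det(D)^n (-1)^\pi (-1)^\sigma = 1$ in $\Bbbk$. Then the map $L: X \mapsto \omega^m D^n P_\pi X P_\sigma$ on $d\times d$ matrices over $\Bbbk$ is an element of $G$ (that is, $L$ is a symmetry of the power sum decomposition of the determinant described in the context).
   Context: Let $d\ge 1$ be an integer, $\Bbbk$ a field in which $d!$ is invertible, and $\omega\in\Bbbk$ a primitive $d$th root of unity. $S_d$ is the symmetric group on $[d]$, $\sigma i$ is $\sigma$ applied to $i$, and $(-1)^\sigma$ is the sign of $\sigma$. Let $E_{i,j}$ be the $d\times d$ matrix with $1$ in position $(i,j)$ and $0$ elsewhere. For $\sigma\in S_d$ let $P_\sigma=\sum_{i=1}^d E_{i,\sigma i}$. Let $D=\operatorname{diag}(\omega,\omega^2,\dots,\omega^d)$. Let $M=\{\omega^k D^j P_\sigma : k,j\in\mathbb{Z},\ \sigma\in S_d\}$, a finite set of $d\times d$ matrices. $\operatorname{Aff}_d$ is the set of permutations $\sigma\in S_d$ for which there exist $a,b\in[d]$ with $\sigma i\equiv ai+b \pmod d$ for all $i\in[d]$. The decomposition in question is \[ d \cdot d!\,\det(x_{i,j}) = \sum_{\sigma \in S_d} (-1)^{\sigma} \sum_{j=1}^d (-1)^{(d+1)j} \Big( \sum_{i=1}^d \omega^{ij} x_{i,\sigma i} \Big)^d ; \] the linear form in the $(\sigma,j)$ term has coefficient matrix $D^jP_\sigma$. Let $V$ be the $\Bbbk$-vector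 space spanned by the variables $x_{i,j}$, $1\le i,j\le d$, identified with the space of $d\times d$ matrices over $\Bbbk$ by sending a linear form to its matrix of coefficients. Let $\tilde G$ be the group of linear automorphisms of $V$ which leave the set $M$ invariant, and let $G$ be the subgroup of those $L\in\tilde G$ which preserve the determinant, meaning $\det(L(X))=\det(X)$ for all $X$ (as a polynomial identity in the entries of $X$). Elements of $G$ are called the symmetries of the decomposition. *)

theory Defs
  imports
    "Jordan_Normal_Form.Determinant"
    "Jordan_Normal_Form.VS_Connect"
    "HOL-Library.Poly_Mapping"
    "HOL-Number_Theory.Cong"
    "HOL-Algebra.Bij"
    "HOL-Combinatorics.Permutations"
begin

text \<open>
  Mathematical indices run through \<open>{1..d}\<close>, whereas the entries of a matrix of type \<open>'a mat\<close> are
  indexed from 0. The entry in mathematical position \<open>(i, j)\<close> is therefore \<open>A $$ (i - 1, j - 1)\<close>.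
\<close>

definition primitive_root_unity :: "nat \<Rightarrow> 'k::field \<Rightarrow> bool" where
  "primitive_root_unity d \<omega> \<longleftrightarrow> \<omega> ^ d = 1 \<and> (\<forall>k. 0 < k \<and> k < d \<longrightarrow> \<omega> ^ k \<noteq> 1)"

definition elem_mat :: "nat \<Rightarrow> nat \<Rightarrow> nat \<Rightarrow> 'k::field mat" where
  "elem_mat d i j = mat d d (\<lambda>(k, l). if Suc k = i \<and> Suc l = j then 1 else 0)"

definition perm_mat :: "nat \<Rightarrow> (nat \<Rightarrow> nat) \<Rightarrow> 'k::field mat" where
  "perm_mat d \<sigma> = mat d d (\<lambda>(k, l). \<Sum>i = 1..d. elem_mat d i (\<sigma> i) $$ (k, l))"

lemma perm_mat_alt:
  "(perm_mat d \<sigma> :: 'k::field mat) = mat d d (\<lambda>(k, l). if \<sigma> (Suc k) = Suc l then 1 else 0)"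
proof -
  have "(\<Sum>i = 1..d. elem_mat d i (\<sigma> i) $$ (k, l)) = (if \<sigma> (Suc k) = Suc l then 1 else (0::'k))"
    if "k < d" "l < d" for k l
  proof -
    have "(\<Sum>i = 1..d. elem_mat d i (\<sigma> i) $$ (k, l)) =
        (\<Sum>i = 1..d. if i = Suc k then (if \<sigma> (Suc k) = Suc l then 1 else (0::'k)) else 0)"
      using that by (intro sum.cong) (auto simp: elem_mat_def)
    also have "\<dots> = (if \<sigma> (Suc k) = Suc l then 1 else 0)"
      using that by (subst sum.delta) auto
    finally show ?thesis .
  qed
  then show ?thesis by (intro eq_matI) (simp_all add: perm_mat_def del: One_nat_def)
qed

definition diag_root :: "nat \<Rightarrow> 'k::field \<Rightarrow> 'k mat" where
  "diag_root d \<omega> = mat_diag d (\<lambda>i. \<omega> ^ Suc i)"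

text \<open>Since the exponent of the diagonal matrix is an integer, its power is taken in the monoid of
  square matrices; negative powers are powers of the inverse matrix.\<close>

definition mat_set :: "nat \<Rightarrow> 'k::field \<Rightarrow> 'k mat set" where
  "mat_set d \<omega> =
    {(\<omega> powi k) \<cdot>\<^sub>m ((diag_root d \<omega> [^]\<^bsub>ring_mat TYPE('k) d ()\<^esub> j) * perm_mat d \<sigma>)
      | (k::int) (j::int) \<sigma>. \<sigma> permutes {1..d}}"

definition Aff :: "nat \<Rightarrow> (nat \<Rightarrow> nat) set" where
  "Aff d = {\<sigma>. \<sigma> permutes {1..d} \<and>
     (\<exists>a\<in>{1..d}. \<exists>b\<in>{1..d}. \<forall>i\<in>{1..d}. [\<sigma> i = a * i + b] (mod d))}"

text \<open>Maps on matrices are extensional, as in \<^const>\<open>BijGroup\<close>, so that they are determined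
  by their values on \<open>d \<times> d\<close> matrices. The group operation is composition.\<close>

definition lin_auts :: "nat \<Rightarrow> ('k::field mat \<Rightarrow> 'k mat) set" where
  "lin_auts d = Bij (carrier_mat d d) \<inter>
     LinearCombinations.module_hom class_ring (module_mat TYPE('k) d d) (module_mat TYPE('k) d d)"

definition G_tilde :: "nat \<Rightarrow> 'k::field \<Rightarrow> ('k mat \<Rightarrow> 'k mat) set" where
  "G_tilde d \<omega> = {L \<in> lin_auts d. L ` mat_set d \<omega> = mat_set d \<omega>}"

text \<open>
  Polynomials in the variables \<open>x\<^sub>i\<^sub>,\<^sub>j\<close> are finitely supported functions from monomials to
  coefficients, with the convolution product; a monomial is a finitely supported function from
  pairs of indices to exponents. A linear map \<open>L\<close> is applied to the matrix of variables by extension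
  of scalars: the image of \<open>X = (\<Sum>k, l. x\<^sub>k\<^sub>,\<^sub>l E\<^sub>k\<^sub>,\<^sub>l)\<close> is \<open>\<Sum>k, l. x\<^sub>k\<^sub>,\<^sub>l L(E\<^sub>k\<^sub>,\<^sub>l)\<close>. In this way
  preservation of the determinant is an identity of polynomials, which does not presuppose that
  a polynomial over a finite field is determined by its values.
\<close>

type_synonym 'k mpoly = "((nat \<times> nat) \<Rightarrow>\<^sub>0 nat) \<Rightarrow>\<^sub>0 'k"

definition mconst :: "'k::field \<Rightarrow> 'k mpoly" where
  "mconst c = Poly_Mapping.single 0 c"

definition mvar :: "nat \<Rightarrow> nat \<Rightarrow> 'k::field mpoly" where
  "mvar i j = Poly_Mapping.single (Poly_Mapping.single (i, j) 1) 1"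

definition generic_mat :: "nat \<Rightarrow> 'k::field mpoly mat" where
  "generic_mat d = mat d d (\<lambda>(i, j). mvar (Suc i) (Suc j))"

definition generic_image :: "nat \<Rightarrow> ('k::field mat \<Rightarrow> 'k mat) \<Rightarrow> 'k mpoly mat" where
  "generic_image d L = mat d d (\<lambda>(i, j).
     \<Sum>k = 1..d. \<Sum>l = 1..d. mvar k l * mconst (L (elem_mat d k l) $$ (i, j)))"

lemma generic_image_id: "generic_image d (\<lambda>X. X) = generic_mat d"
proof (intro eq_matI; simp add: generic_image_def generic_mat_def)
  fix i j assume ij: "i < d" "j < d"
  have "(\<Sum>k = 1..d. \<Sum>l = 1..d. mvar k l * mconst (elem_mat d k l $$ (i, j))) =
      (\<Sum>k = 1..d. if k = Suc i then (\<Sum>l = 1..d. if l = Suc j then mvar k l else 0)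
        else (0 :: 'a mpoly))"
  proof (rule sum.cong[OF refl])
    fix k
    have "mvar k l * mconst (elem_mat d k l $$ (i, j)) =
        (if k = Suc i then (if l = Suc j then mvar k l else 0) else (0 :: 'a mpoly))" for l
      using ij by (auto simp: elem_mat_def mconst_def)
    then show "(\<Sum>l = 1..d. mvar k l * mconst (elem_mat d k l $$ (i, j))) =
        (if k = Suc i then (\<Sum>l = 1..d. if l = Suc j then mvar k l else 0) else (0 :: 'a mpoly))"
      by simp
  qed
  also have "\<dots> = mvar (Suc i) (Suc j)"
    using ij by (subst sum.delta, simp, subst sum.delta) auto
  finally show "(\<Sum>k = Suc 0..d. \<Sum>l = Suc 0..d. mvar k l * mconst (elem_mat d k l $$ (i, j))) =
      (mvar (Suc i) (Suc j) :: 'a mpoly)" by simp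
qed

definition preserves_det :: "nat \<Rightarrow> ('k::field mat \<Rightarrow> 'k mat) \<Rightarrow> bool" where
  "preserves_det d L \<longleftrightarrow> det (generic_image d L) = det (generic_mat d :: 'k mpoly mat)"

definition G_sym :: "nat \<Rightarrow> 'k::field \<Rightarrow> ('k mat \<Rightarrow> 'k mat) set" where
  "G_sym d \<omega> = {L \<in> G_tilde d \<omega>. preserves_det d L}"

end

theory Submission
  imports Defs
begin

text \<open>
  Multiplication by \<open>P\<^sub>\<pi>\<close> on the left and \<open>P\<^sub>\<sigma>\<close> on the right permutes rows and columns, so the map
  is an invertible monomial substitution of the matrix entries. It sends \<open>M\<close> into itself because an
  affine \<open>\<pi>\<close> turns \<open>D\<^sup>j\<close> into a scalar multiple of a power of \<open>D\<close>; as \<open>M\<close> is finite, injectivity makes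
  this a bijection of \<open>M\<close>. The determinant of the generic matrix is multiplied by
  \<open>\<omega>\<^sup>m\<^sup>d det(D)\<^sup>n (-1)\<^sup>\<pi> (-1)\<^sup>\<sigma>\<close>, which is 1.
\<close>

section \<open>Permutation matrices as reindexing of rows and columns\<close>

text \<open>Row \<open>r\<close> of \<open>P_\<pi>\<close> has its only 1 at 1-based column
  \<open>\<pi> (Suc r)\<close>, so each scalar product has a single surviving term.\<close>

lemma perm_mat_mult_left:
  assumes "\<pi> permutes {1..d}" "X \<in> carrier_mat d nc"
  shows "perm_mat d \<pi> * X = mat d nc (\<lambda>(r, c). X $$ (\<pi> (Suc r) - 1, c))"
proof (rule eq_matI)
  fix r c assume "r < dim_row (mat d nc (\<lambda>(r, c). X $$ (\<pi> (Suc r) - 1, c)))"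
    and "c < dim_col (mat d nc (\<lambda>(r, c). X $$ (\<pi> (Suc r) - 1, c)))"
  then have rc: "r < d" "c < nc" by auto
  \<comment> \<open>The value is positive, so the truncated subtraction of 1 is exact and lands
    below \<open>d\<close>.\<close>
  have "\<pi> (Suc r) \<in> {1..d}"
    using rc permutes_in_image[OF assms(1), of "Suc r"] by auto
  then have p: "\<pi> (Suc r) = Suc l \<longleftrightarrow> l = \<pi> (Suc r) - 1" "\<pi> (Suc r) - 1 < d" for l by auto
  then show "(perm_mat d \<pi> * X) $$ (r, c) = mat d nc (\<lambda>(r, c). X $$ (\<pi> (Suc r) - 1, c)) $$ (r, c)"
    using rc assms(2)
    by (simp add: perm_mat_alt scalar_prod_def if_distrib[of "\<lambda>x. x * _"] cong: if_cong)
qed (use assms in \<open>auto simp: perm_mat_alt\<close>)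

text \<open>Column \<open>c\<close> has its only 1 in the row that \<sigma> sends to
  \<open>Suc c\<close>; hence the inverse here, in contrast to multiplication on the left.\<close>

lemma perm_mat_mult_right:
  assumes "\<sigma> permutes {1..d}" "X \<in> carrier_mat nr d"
  shows "X * perm_mat d \<sigma> = mat nr d (\<lambda>(r, c). X $$ (r, inv_into UNIV \<sigma> (Suc c) - 1))"
proof (rule eq_matI)
  fix r c assume "r < dim_row (mat nr d (\<lambda>(r, c). X $$ (r, inv_into UNIV \<sigma> (Suc c) - 1)))"
    and "c < dim_col (mat nr d (\<lambda>(r, c). X $$ (r, inv_into UNIV \<sigma> (Suc c) - 1)))"
  then have rc: "r < nr" "c < d" by auto
  have "inv_into UNIV \<sigma> (Suc c) \<in> {1..d}"
    using rc permutes_in_image[OF permutes_inv[OF assms(1)], of "Suc c"] by auto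
  then obtain s where s: "inv_into UNIV \<sigma> (Suc c) = Suc s" "s < d"
    by (cases "inv_into UNIV \<sigma> (Suc c)") auto
  have "\<sigma> (Suc l) = Suc c \<longleftrightarrow> l = s" for l
    using permutes_inv_eq[OF assms(1), of "Suc c" "Suc l"] by (auto simp: s(1))
  then show "(X * perm_mat d \<sigma>) $$ (r, c) =
      mat nr d (\<lambda>(r, c). X $$ (r, inv_into UNIV \<sigma> (Suc c) - 1)) $$ (r, c)"
    using rc assms(2) s
    by (simp add: perm_mat_alt scalar_prod_def if_distrib[of "\<lambda>x. _ * x"] cong: if_cong)
qed (use assms in \<open>auto simp: perm_mat_alt\<close>)

lemma mat_diag_pow: "mat_diag d f ^\<^sub>m n = mat_diag d (\<lambda>i. f i ^ n :: 'a::comm_semiring_1)"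
proof (induction n)
  case 0
  show ?case by (simp add: mat_diag_def)
qed (simp add: mult.commute)

text \<open>The factor \<open>D^n\<close> scales the 0-based row \<open>r\<close> by
  \<open>\<omega> ^ (n * Suc r)\<close>, while the permutation matrices only move entries. All later
  arguments work with this entry formula.\<close>

lemma symmetry_map_eq:
  assumes "\<pi> permutes {1..d}" "\<sigma> permutes {1..d}" "X \<in> carrier_mat d d"
  shows "\<omega> ^ m \<cdot>\<^sub>m ((diag_root d \<omega> ^\<^sub>m n) * perm_mat d \<pi> * X * perm_mat d \<sigma>) =
    mat d d (\<lambda>(r, c). \<omega> ^ (m + n * Suc r) * X $$ (\<pi> (Suc r) - 1, inv_into UNIV \<sigma> (Suc c) - 1))"
proof -
  have b: "inv_into UNIV \<sigma> (Suc c) - 1 < d" if "c < d" for c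
    using that permutes_in_image[OF permutes_inv[OF assms(2)], of "Suc c"] by auto
  have P: "perm_mat d \<pi> \<in> carrier_mat d d" by (simp add: perm_mat_alt)
  have "diag_root d \<omega> ^\<^sub>m n * perm_mat d \<pi> * X = diag_root d \<omega> ^\<^sub>m n * (perm_mat d \<pi> * X)"
    using assms P by (intro assoc_mult_mat[of _ d d _ d]) (auto simp: diag_root_def)
  also have "\<dots> = mat d d (\<lambda>(r, c). \<omega> ^ (n * Suc r) * X $$ (\<pi> (Suc r) - 1, c))" (is "_ = ?DPX")
  proof -
    have "(\<omega> ^ Suc r) ^ n = \<omega> ^ (n * Suc r)" for r
      by (metis power_mult mult.commute)
    then have "diag_root d \<omega> ^\<^sub>m n = mat_diag d (\<lambda>r. \<omega> ^ (n * Suc r))"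
      by (simp only: diag_root_def mat_diag_pow)
    then show ?thesis
      by (simp only: perm_mat_mult_left[OF assms(1,3)], subst mat_diag_mult_left[of _ d d]) auto
  qed
  finally have "diag_root d \<omega> ^\<^sub>m n * perm_mat d \<pi> * X * perm_mat d \<sigma> = mat d d
      (\<lambda>(r, c). \<omega> ^ (n * Suc r) * X $$ (\<pi> (Suc r) - 1, inv_into UNIV \<sigma> (Suc c) - 1))"
    using perm_mat_mult_right[OF assms(2), of ?DPX d] b by (auto intro!: eq_matI)
  then show ?thesis
    by (simp only:) (auto simp: power_add)
qed

section \<open>The finite set \<open>M\<close> and the affine action on it\<close>

text \<open>Negative powers are powers of the ring inverse, which uniqueness of two-sided inverses
  identifies with the entrywise reciprocal.\<close>

lemma int_pow_mat_diag:
  fixes f :: "nat \<Rightarrow> 'k::field"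
  assumes "\<And>i. i < d \<Longrightarrow> f i \<noteq> 0"
  shows "mat_diag d f [^]\<^bsub>ring_mat TYPE('k) d b\<^esub> (j::int) = mat_diag d (\<lambda>i. f i powi j)"
proof -
  interpret ring "ring_mat TYPE('k) d b" by (rule ring_mat)
  have nat: "mat_diag d f [^]\<^bsub>ring_mat TYPE('k) d b\<^esub> (l::nat) = mat_diag d (\<lambda>i. f i ^ l)" for l
    by (induction l) (auto simp: ring_mat_def mult.commute)
  show ?thesis
  proof (cases "j < 0")
    case True
    \<comment> \<open>Only diagonal positions below \<open>d\<close> are compared, since
      nonvanishing is known only there.\<close>
    have cong: "mat_diag d g = mat_diag d h" if "\<And>i. i < d \<Longrightarrow> g i = h i" for g h :: "nat \<Rightarrow> 'k"
      using that by (auto simp: mat_diag_def intro!: eq_matI)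
    have "inv\<^bsub>ring_mat TYPE('k) d b\<^esub> mat_diag d (\<lambda>i. f i ^ nat (- j)) = mat_diag d (\<lambda>i. f i powi j)"
    proof (rule inv_unique'[symmetric])
      have "mat_diag d (\<lambda>i. f i ^ nat (- j) * f i powi j) = 1\<^sub>m d"
        unfolding mat_diag_one[symmetric]
        using True assms by (intro cong) (auto simp: power_int_def field_simps)
      then show "mat_diag d (\<lambda>i. f i ^ nat (- j)) \<otimes>\<^bsub>ring_mat TYPE('k) d b\<^esub>
          mat_diag d (\<lambda>i. f i powi j) = \<one>\<^bsub>ring_mat TYPE('k) d b\<^esub>"
        and "mat_diag d (\<lambda>i. f i powi j) \<otimes>\<^bsub>ring_mat TYPE('k) d b\<^esub>
          mat_diag d (\<lambda>i. f i ^ nat (- j)) = \<one>\<^bsub>ring_mat TYPE('k) d b\<^esub>"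
        by (auto simp: ring_mat_def mult.commute)
    qed (auto simp: ring_mat_def)
    then show ?thesis using True by (simp add: int_pow_def2 nat)
  next
    case False
    then show ?thesis by (simp add: int_pow_def2 nat power_int_def)
  qed
qed

text \<open>The matrix \<open>\<omega>^k D^j P_\<tau>\<close> in entry form, so that acting on
  \<open>M\<close> becomes arithmetic with exponents.\<close>

definition monomial_mat :: "nat \<Rightarrow> 'k::field \<Rightarrow> int \<Rightarrow> int \<Rightarrow> (nat \<Rightarrow> nat) \<Rightarrow> 'k mat" where
  "monomial_mat d \<omega> k j \<tau> =
    mat d d (\<lambda>(r, c). if \<tau> (Suc r) = Suc c then \<omega> powi (k + j * int (Suc r)) else 0)"

lemma mat_set_eq:
  fixes \<omega> :: "'k::field"
  assumes "\<omega> \<noteq> 0"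
  shows "mat_set d \<omega> = {monomial_mat d \<omega> k j \<tau> | k j \<tau>. \<tau> permutes {1..d}}"
proof -
  have "(\<omega> powi k) \<cdot>\<^sub>m ((diag_root d \<omega> [^]\<^bsub>ring_mat TYPE('k) d ()\<^esub> j) * perm_mat d \<tau>) =
      monomial_mat d \<omega> k j \<tau>" for k j :: int and \<tau>
  proof -
    have e: "(\<omega> ^ Suc i) powi j = \<omega> powi (j * int (Suc i))" for i
      by (metis power_int_mult power_int_of_nat mult.commute)
    have "diag_root d \<omega> [^]\<^bsub>ring_mat TYPE('k) d ()\<^esub> j = mat_diag d (\<lambda>i. \<omega> powi (j * int (Suc i)))"
      unfolding diag_root_def using assms by (subst int_pow_mat_diag) (auto simp only: e, auto)
    then show ?thesis
      using assms
      by (simp only:, subst mat_diag_mult_left[of _ d d])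
        (auto simp: perm_mat_alt monomial_mat_def power_int_add)
  qed
  then show ?thesis by (simp add: mat_set_def)
qed

lemma primitive_root_unity_nonzero:
  "primitive_root_unity d \<omega> \<Longrightarrow> d \<ge> 1 \<Longrightarrow> \<omega> \<noteq> 0"
  by (auto simp: primitive_root_unity_def power_0_left)

text \<open>Through this the congruence defining \<open>Aff\<close> becomes an equality of matrix
  entries.\<close>

lemma powi_cong_mod:
  fixes \<omega> :: "'k::field"
  assumes "\<omega> ^ d = 1" "\<omega> \<noteq> 0" "[a = b] (mod int d)"
  shows "\<omega> powi a = \<omega> powi b"
proof -
  obtain l where "a = b + int d * l"
    using assms(3) cong_iff_lin[of b a "int d"] by (auto simp: cong_sym_eq)
  then show ?thesis
    using assms by (simp add: power_int_add power_int_mult)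
qed

text \<open>As \<open>\<omega> ^ d = 1\<close>, both exponents can be reduced modulo
  \<open>d\<close>, leaving finitely many triples \<open>(k, j, \<tau>)\<close>.\<close>

lemma finite_mat_set:
  fixes \<omega> :: "'k::field"
  assumes "\<omega> ^ d = 1" "\<omega> \<noteq> 0" "d \<ge> 1"
  shows "finite (mat_set d \<omega>)"
proof (rule finite_subset)
  show "mat_set d \<omega> \<subseteq> (\<lambda>(k, j, \<tau>). monomial_mat d \<omega> k j \<tau>) `
      ({0..<int d} \<times> {0..<int d} \<times> {\<tau>. \<tau> permutes {1..d}})"
  proof
    fix A assume "A \<in> mat_set d \<omega>"
    then obtain k j \<tau> where A: "A = monomial_mat d \<omega> k j \<tau>" "\<tau> permutes {1..d}"
      by (auto simp: mat_set_eq[OF assms(2)])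
    have "\<omega> powi (k + j * i) = \<omega> powi (k mod d + j mod d * i)" for i
      by (rule powi_cong_mod[OF assms(1,2)]) (intro cong_add cong_mult, simp_all add: cong_def)
    then have "A = monomial_mat d \<omega> (k mod d) (j mod d) \<tau>"
      unfolding A monomial_mat_def by (intro eq_matI) auto
    then show "A \<in> (\<lambda>(k, j, \<tau>). monomial_mat d \<omega> k j \<tau>) `
      ({0..<int d} \<times> {0..<int d} \<times> {\<tau>. \<tau> permutes {1..d}})"
      using A(2) assms(3) by (intro image_eqI[of _ _ "(k mod d, j mod d, \<tau>)"]) auto
  qed
  show "finite ((\<lambda>(k, j, \<tau>). monomial_mat d \<omega> k j \<tau>) `
      ({0..<int d} \<times> {0..<int d} \<times> {\<tau>. \<tau> permutes {1..d}}))"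
    by (intro finite_imageI finite_cartesian_product finite_permutations) auto
qed

text \<open>An affine \<open>\<pi>\<close> with \<open>\<pi> i \<equiv> a i + b\<close> satisfies \<open>P\<^sub>\<pi> D\<^sup>j = \<omega>\<^sup>j\<^sup>b D\<^sup>j\<^sup>a P\<^sub>\<pi>\<close>.\<close>
lemma affine_action_monomial_mat:
  fixes \<omega> :: "'k::field"
  assumes "\<omega> ^ d = 1" "\<omega> \<noteq> 0" "\<pi> permutes {1..d}" "\<sigma> permutes {1..d}"
    and aff: "\<And>i. i \<in> {1..d} \<Longrightarrow> [\<pi> i = a * i + b] (mod d)"
  shows "mat d d (\<lambda>(r, c). \<omega> ^ (m + n * Suc r) *
      monomial_mat d \<omega> k j \<tau> $$ (\<pi> (Suc r) - 1, inv_into UNIV \<sigma> (Suc c) - 1)) =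
    monomial_mat d \<omega> (int m + k + j * int b) (int n + j * int a) (\<sigma> \<circ> \<tau> \<circ> \<pi>)"
    (is "?A = ?B")
proof (rule eq_matI)
  fix r c assume "r < dim_row ?B" "c < dim_col ?B"
  then have rc: "r < d" "c < d" by (auto simp: monomial_mat_def)
  have p: "\<pi> (Suc r) \<in> {1..d}" "inv_into UNIV \<sigma> (Suc c) \<in> {1..d}"
    using rc permutes_in_image[OF assms(3), of "Suc r"]
      permutes_in_image[OF permutes_inv[OF assms(4)], of "Suc c"] by auto
  \<comment> \<open>The congruence is lifted to the integers because \<open>k\<close> and
    \<open>j\<close> may be negative.\<close>
  have "[int (\<pi> (Suc r)) = int a * int (Suc r) + int b] (mod int d)"
    using aff[of "Suc r"] rc cong_int_iff[of "\<pi> (Suc r)" "a * Suc r + b" d]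
    by (simp only: of_nat_add of_nat_mult atLeastAtMost_iff) simp
  then have "[int m + int n * int (Suc r) + (k + j * int (\<pi> (Suc r))) =
      int m + int n * int (Suc r) + (k + j * (int a * int (Suc r) + int b))] (mod int d)"
    by (intro cong_add cong_mult cong_refl)
  \<comment> \<open>Sorting the exponent into a constant part and a multiple of \<open>Suc r\<close>
    yields the new scalar exponent and the new power of \<open>D\<close>.\<close>
  then have "\<omega> powi (int m + int n * int (Suc r) + (k + j * int (\<pi> (Suc r)))) =
      \<omega> powi (int m + k + j * int b + (int n + j * int a) * int (Suc r))"
    using powi_cong_mod[OF assms(1,2)] by (simp add: algebra_simps)
  moreover have "\<omega> ^ (m + n * Suc r) = \<omega> powi (int m + int n * int (Suc r))"
    by (metis of_nat_add of_nat_mult power_int_of_nat)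
  ultimately have "\<omega> ^ (m + n * Suc r) * \<omega> powi (k + j * int (\<pi> (Suc r))) =
      \<omega> powi (int m + k + j * int b + (int n + j * int a) * int (Suc r))"
    using assms(2) by (simp add: power_int_add)
  \<comment> \<open>The supports agree: with ones at \<open>(i, \<sigma> i)\<close>, products of
    permutation matrices reverse composition, so \<open>P_\<pi> P_\<tau> P_\<sigma>\<close> belongs
    to \<open>\<sigma> \<circ> \<tau> \<circ> \<pi>\<close>.\<close>
  moreover have "\<tau> (\<pi> (Suc r)) = inv_into UNIV \<sigma> (Suc c) \<longleftrightarrow> \<sigma> (\<tau> (\<pi> (Suc r))) = Suc c"
    using permutes_inverses[OF assms(4)] by metis
  ultimately show "?A $$ (r, c) = ?B $$ (r, c)"
    using rc p by (auto simp: monomial_mat_def)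
qed (auto simp: monomial_mat_def)

section \<open>Constants and determinants over the polynomial ring\<close>

lemma mconst_mult: "mconst (a * b) = mconst a * mconst b"
  by (simp add: mconst_def mult_single)

lemma mconst_1: "mconst 1 = 1"
  by (simp add: mconst_def)

lemma mconst_prod: "mconst (\<Prod>i\<in>A. f i) = (\<Prod>i\<in>A. mconst (f i))"
  by (induction A rule: infinite_finite_induct) (auto simp: mconst_mult mconst_1)

lemma mconst_minus_1: "mconst (- 1) = - 1"
  by (simp add: mconst_def single_uminus)

lemma mconst_of_int_sign: "mconst (of_int (sign p)) = of_int (sign p)"
  by (cases "sign p = 1") (auto simp: sign_def mconst_1 mconst_minus_1)

lemma det_mat_diag: "det (mat_diag d u) = (\<Prod>i<d. u i)"
  by (subst det_upper_triangular[of _ d])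
    (auto simp: prod_list_diag_prod mat_diag_def lessThan_atLeast0)

text \<open>The matrix factors as \<open>mat_diag d u * C\<close>, where \<open>C\<close> arises
  from \<open>A\<close> by permuting columns, treated as rows of the transpose, and then
  rows.\<close>

lemma det_scale_permute:
  assumes "p permutes {0..<d}" "q permutes {0..<d}" "A \<in> carrier_mat d d"
  shows "det (mat d d (\<lambda>(i, j). u i * A $$ (p i, q j))) =
    (\<Prod>i<d. u i) * of_int (sign p) * of_int (sign q) * det A"
proof -
  define B where "B = mat d d (\<lambda>(i, j). A\<^sup>T $$ (q i, j))"
  have B: "B \<in> carrier_mat d d" by (simp add: B_def)
  have "det B = of_int (sign q) * det A"
    using assms by (simp add: B_def det_permute_rows[of _ d] det_transpose[of _ d])
  moreover define C where "C = mat d d (\<lambda>(i, j). B\<^sup>T $$ (p i, j))"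
  ultimately have "det C = of_int (sign p) * (of_int (sign q) * det A)"
    using assms B by (simp add: det_permute_rows[of _ d] det_transpose[of _ d])
  moreover have C: "C \<in> carrier_mat d d" by (simp add: C_def)
  have "mat d d (\<lambda>(i, j). u i * A $$ (p i, q j)) = mat_diag d u * C"
    unfolding mat_diag_mult_left[OF C]
    using assms permutes_in_image[OF assms(1)] permutes_in_image[OF assms(2)]
    by (intro eq_matI) (auto simp: C_def B_def)
  ultimately show ?thesis
    using det_mult[OF mat_diag_dim C, of u] by (simp add: det_mat_diag mult.assoc)
qed

text \<open>By linearity, a rule that moves and scales the entries of every \<open>elem_mat\<close>
  acts in the same way on the matrix of variables.\<close>

lemma generic_image_monomial:
  assumes "\<And>i. i < d \<Longrightarrow> p i < d" "\<And>j. j < d \<Longrightarrow> q j < d"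
    and "\<And>k l i j. i < d \<Longrightarrow> j < d \<Longrightarrow>
      L (elem_mat d k l) $$ (i, j) = u i * elem_mat d k l $$ (p i, q j)"
  shows "generic_image d L = mat d d (\<lambda>(i, j). mconst (u i) * generic_mat d $$ (p i, q j))"
proof (rule eq_matI)
  fix i j assume "i < dim_row (mat d d (\<lambda>(i, j). mconst (u i) * generic_mat d $$ (p i, q j)))"
    and "j < dim_col (mat d d (\<lambda>(i, j). mconst (u i) * generic_mat d $$ (p i, q j)))"
  then have ij: "i < d" "j < d" by auto
  then have "generic_image d L $$ (i, j) = (\<Sum>k = 1..d. \<Sum>l = 1..d.
      mvar k l * (mconst (u i) * mconst (elem_mat d k l $$ (p i, q j))))"
    by (simp add: generic_image_def assms(3) mconst_mult)
  \<comment> \<open>Once the scalar is pulled out, the remaining double sum is the generic image of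
    the identity map.\<close>
  also have "\<dots> = mconst (u i) * generic_image d (\<lambda>X. X) $$ (p i, q j)"
    using ij assms(1,2) by (simp add: generic_image_def sum_distrib_left mult.left_commute)
  finally show "generic_image d L $$ (i, j) =
      mat d d (\<lambda>(i, j). mconst (u i) * generic_mat d $$ (p i, q j)) $$ (i, j)"
    using ij by (simp add: generic_image_id)
qed (auto simp: generic_image_def)

text \<open>Conjugation by the bijection \<open>i \<mapsto> i - 1\<close> passes from mathematical
  indices to matrix indices and keeps the sign.\<close>

lemma shift_permutation:
  assumes "\<pi> permutes {1..d}"
  obtains p where "p permutes {0..<d}" "sign p = sign \<pi>"
    "\<And>i. i < d \<Longrightarrow> p i = \<pi> (Suc i) - 1"
proof
  let ?p = "map_permutation {1..d} (\<lambda>i. i - 1) \<pi>"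
  have inj: "inj_on (\<lambda>i::nat. i - 1) {1..d}" by (auto simp: inj_on_def)
  have bij: "bij_betw (\<lambda>i::nat. i - 1) {1..d} {0..<d}"
    by (rule bij_betw_byWitness[where f' = Suc]) auto
  show "?p permutes {0..<d}" by (rule map_permutation_permutes[OF bij assms])
  show "sign ?p = sign \<pi>" by (rule sign_map_permutation[OF inj assms]) simp
  show "?p i = \<pi> (Suc i) - 1" if "i < d" for i
    using map_permutation_apply[OF inj, of "Suc i" \<pi>] that by simp
qed

section \<open>Verification of the conditions defining \<open>G_sym\<close>\<close>

theorem theorem6:
  fixes d m n :: nat and \<omega> :: "'k::field" and \<pi> \<sigma> :: "nat \<Rightarrow> nat"
  assumes "d \<ge> 1"
    and "of_nat (fact d) \<noteq> (0 :: 'k)"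
    and "primitive_root_unity d \<omega>"
    and "m \<in> {1..d}" and "n \<in> {1..d}"
    and "\<pi> \<in> Aff d" and "\<sigma> permutes {1..d}"
    and "det (diag_root d \<omega>) ^ n * of_int (sign \<pi>) * of_int (sign \<sigma>) = (1 :: 'k)"
  shows "(\<lambda>X\<in>carrier_mat d d.
      \<omega> ^ m \<cdot>\<^sub>m ((diag_root d \<omega> ^\<^sub>m n) * perm_mat d \<pi> * X * perm_mat d \<sigma>)) \<in> G_sym d \<omega>"
    (is "?L \<in> _")
proof -
  have \<omega>: "\<omega> ^ d = 1" "\<omega> \<noteq> 0"
    using assms(1,3) primitive_root_unity_nonzero by (auto simp: primitive_root_unity_def)
  obtain a b where \<pi>: "\<pi> permutes {1..d}"
    and aff: "\<And>i. i \<in> {1..d} \<Longrightarrow> [\<pi> i = a * i + b] (mod d)"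
    using assms(6) unfolding Aff_def by blast
  obtain p where p: "p permutes {0..<d}" "sign p = sign \<pi>"
      "\<And>i. i < d \<Longrightarrow> p i = \<pi> (Suc i) - 1"
    using shift_permutation[OF \<pi>] by blast
  obtain q where q: "q permutes {0..<d}" "sign q = sign (inv_into UNIV \<sigma>)"
      "\<And>j. j < d \<Longrightarrow> q j = inv_into UNIV \<sigma> (Suc j) - 1"
    using shift_permutation[OF permutes_inv[OF assms(7)]] by blast
  have pq: "p i < d" "q i < d" "inv_into UNIV p i < d" "inv_into UNIV q i < d" if "i < d" for i
    using that p(1) q(1) permutes_in_image[of _ "{0..<d}" i] permutes_inv[of _ "{0..<d}"] by auto
  define u where "u = (\<lambda>i. \<omega> ^ (m + n * Suc i))"
  have u: "u i \<noteq> 0" for i using \<omega>(2) by (simp add: u_def)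
  have L: "?L X = mat d d (\<lambda>(i, j). u i * X $$ (p i, q j))" if "X \<in> carrier_mat d d" for X
    using that by (auto simp: symmetry_map_eq[OF \<pi> assms(7)] p q u_def intro!: eq_matI)
  \<comment> \<open>The form with \<open>p\<close> and \<open>q\<close> serves bijectivity,
    linearity and the determinant; this one, with \<pi> and \<sigma>, matches the affine action on
    \<open>M\<close>.\<close>
  have L': "?L X = mat d d (\<lambda>(i, j). \<omega> ^ (m + n * Suc i) *
      X $$ (\<pi> (Suc i) - 1, inv_into UNIV \<sigma> (Suc j) - 1))" if "X \<in> carrier_mat d d" for X
    using that by (simp add: symmetry_map_eq[OF \<pi> assms(7)])

  \<comment> \<open>Linear automorphism\<close>
  have bij: "bij_betw ?L (carrier_mat d d) (carrier_mat d d)"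
  proof (rule bij_betw_byWitness)
    \<comment> \<open>The inverse map: row \<open>i\<close> of \<open>X\<close> ends up in row
      \<open>p^-1 i\<close> scaled by \<open>u\<close> at that index, which is therefore the value
      to divide by.\<close>
    let ?K = "\<lambda>Y. mat d d (\<lambda>(i, j).
      Y $$ (inv_into UNIV p i, inv_into UNIV q j) / u (inv_into UNIV p i))"
    show "\<forall>X\<in>carrier_mat d d. ?K (?L X) = X"
      using u pq permutes_inverses[OF p(1)] permutes_inverses[OF q(1)]
      by (auto simp: L simp del: restrict_apply intro!: eq_matI)
    show "\<forall>Y\<in>carrier_mat d d. ?L (?K Y) = Y"
      using u pq permutes_inverses[OF p(1)] permutes_inverses[OF q(1)]
      by (auto simp: L simp del: restrict_apply intro!: eq_matI)
    show "?L ` carrier_mat d d \<subseteq> carrier_mat d d" by (auto simp: L simp del: restrict_apply)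
    show "?K ` carrier_mat d d \<subseteq> carrier_mat d d" by auto
  qed
  have "?L \<in> LinearCombinations.module_hom class_ring
      (module_mat TYPE('k) d d) (module_mat TYPE('k) d d)"
    unfolding LinearCombinations.module_hom_def
    by (auto simp: module_mat_simps L pq algebra_simps simp del: restrict_apply intro!: eq_matI)
  with bij have lin: "?L \<in> lin_auts d" by (auto simp: lin_auts_def Bij_def)

  \<comment> \<open>Invariance of \<open>M\<close>\<close>
  have M: "mat_set d \<omega> \<subseteq> carrier_mat d d"
    by (auto simp: mat_set_eq[OF \<omega>(2)] monomial_mat_def)
  have "?L ` mat_set d \<omega> \<subseteq> mat_set d \<omega>"
  proof
    fix Y assume "Y \<in> ?L ` mat_set d \<omega>"
    then obtain k j \<tau> where Y: "Y = ?L (monomial_mat d \<omega> k j \<tau>)" and \<tau>: "\<tau> permutes {1..d}"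
      by (auto simp: mat_set_eq[OF \<omega>(2)] simp del: restrict_apply)
    have "Y = monomial_mat d \<omega> (int m + k + j * int b) (int n + j * int a) (\<sigma> \<circ> \<tau> \<circ> \<pi>)"
      unfolding Y by (subst L', simp add: monomial_mat_def)
        (rule affine_action_monomial_mat[OF \<omega> \<pi> assms(7) aff])
    moreover have "\<sigma> \<circ> \<tau> \<circ> \<pi> permutes {1..d}"
      using \<pi> \<tau> assms(7) by (intro permutes_compose)
    ultimately show "Y \<in> mat_set d \<omega>" by (auto simp: mat_set_eq[OF \<omega>(2)])
  qed
  moreover have "inj_on ?L (mat_set d \<omega>)"
    by (rule inj_on_subset[OF bij_betw_imp_inj_on[OF bij] M])
  ultimately have "?L ` mat_set d \<omega> = mat_set d \<omega>"
    by (intro endo_inj_surj finite_mat_set \<omega> assms(1))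

  \<comment> \<open>Preservation of the determinant as a polynomial identity\<close>
  moreover have "preserves_det d ?L"
  proof -
    have "?L (elem_mat d k l) $$ (i, j) = u i * elem_mat d k l $$ (p i, q j)"
      if "i < d" "j < d" for i j k l
      using that by (subst L) (auto simp: elem_mat_def)
    then have "generic_image d ?L = mat d d (\<lambda>(i, j). mconst (u i) * generic_mat d $$ (p i, q j))"
      using pq by (intro generic_image_monomial)
    then have "det (generic_image d ?L) =
        (\<Prod>i<d. mconst (u i)) * of_int (sign p) * of_int (sign q) * det (generic_mat d)"
      using det_scale_permute[OF p(1) q(1), of "generic_mat d" "\<lambda>i. mconst (u i)"]
      by (simp add: generic_mat_def)
    \<comment> \<open>All factors are gathered inside \<open>mconst\<close>, so that the determinant
      hypothesis, an equation in the field, can be applied.\<close>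
    also have "\<dots> = mconst ((\<Prod>i<d. u i) * of_int (sign p) * of_int (sign q)) * det (generic_mat d)"
      by (simp add: mconst_mult mconst_prod mconst_of_int_sign)
    also have "(\<Prod>i<d. u i) * of_int (sign p) * of_int (sign q) = 1"
    proof -
      \<comment> \<open>The scalar \<open>\<omega> ^ m\<close> occurs once per row and contributes
        \<open>(\<omega> ^ m) ^ d = 1\<close>; the remaining factors multiply to
        \<open>det(D)^n\<close>.\<close>
      have "u i = \<omega> ^ m * (\<omega> ^ Suc i) ^ n" for i
        unfolding u_def by (metis power_add power_mult mult.commute)
      then have "(\<Prod>i<d. u i) = (\<omega> ^ m) ^ d * (\<Prod>i<d. \<omega> ^ Suc i) ^ n"
        by (simp only: prod.distrib prod_power_distrib prod_constant card_lessThan)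
      also have "(\<omega> ^ m) ^ d = 1"
        using \<omega>(1) by (metis power_mult mult.commute power_one)
      finally have "(\<Prod>i<d. u i) = det (diag_root d \<omega>) ^ n"
        by (simp add: diag_root_def det_mat_diag)
      \<comment> \<open>\<open>q\<close> comes from the inverse of \<sigma>, which has the same sign
        as \<sigma>.\<close>
      moreover have "sign q = sign \<sigma>"
        unfolding q(2) by (rule sign_inverse[OF permutation_permutes[THEN iffD2]])
          (use assms(7) in blast)
      ultimately show ?thesis using assms(8) p(2) by simp
    qed
    finally show ?thesis unfolding preserves_det_def mconst_1 mult_1_left .
  qed
  ultimately show ?thesis using lin unfolding G_sym_def G_tilde_def by blast
qed

end
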